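(* Let $A$, the iterates $u_k$, the corrections $s_k$ and the errors $e_k$ be as in the context. There exists a positive number $\delta$ such that if $\|e_k\|<\delta$ then $$\|s_k\|\le 3\|e_k\|.$$
   Context: $A\in\mathbb{R}^{n\times n}$ is symmetric positive definite with eigenvalues $\lambda_1<\lambda_2<\dots<\lambda_n$ and unit eigenvector $v_1$ for $\lambda_1$. Norms are Euclidean. Newton iteration: $u_0$ is a unit vector; for $k\ge 0$, $\theta_k=u_k^\top A u_k$, and $s_k$ is an (exact or approximate) solution, lying in the subspace orthogonal to $u_k$, of the correction equation $$(I-u_ku_k^\top)(A-\theta_k I)(I-u_ku_k^\top)s_k=-(Au_k-\theta_ku_k).$$ Then $$u_{k+1}=\frac{u_k+s_k}{\|u_k+s_k\|}=\frac{u_k+s_k}{\sqrt{1+\|s_k\|^2}}.$$ Set $e_k=u_k-v_1$. Standing assumption: convergence holds, i.e. there is a constant $r<1$ with $\|e_{k+1}\|<r\|e_k\|$ for all $k\ge0$. The number $\delta$ does not depend on $k$. *)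

theory Defs
  imports "HOL-Analysis.Analysis"
begin

definition eigenvector :: "real^'n^'n \<Rightarrow> real^'n \<Rightarrow> real \<Rightarrow> bool" where
  "eigenvector A v l \<longleftrightarrow> v \<noteq> 0 \<and> A *v v = l *\<^sub>R v"

definition eigenvalue :: "real^'n^'n \<Rightarrow> real \<Rightarrow> bool" where
  "eigenvalue A l \<longleftrightarrow> (\<exists>v. eigenvector A v l)"

definition sym_pos_def :: "real^'n^'n \<Rightarrow> bool" where
  "sym_pos_def A \<longleftrightarrow> transpose A = A \<and> (\<forall>x. x \<noteq> 0 \<longrightarrow> x \<bullet> (A *v x) > 0)"

definition rayleigh :: "real^'n^'n \<Rightarrow> real^'n \<Rightarrow> real" where
  "rayleigh A u = u \<bullet> (A *v u)"

(* I - u u^T *)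
definition proj_perp :: "real^'n \<Rightarrow> real^'n^'n" where
  "proj_perp u = mat 1 - (columnvector u :: real^1^'n) ** (rowvector u :: real^'n^1)"

(* Residual of the correction equation
   (I - u u^T) (A - theta I) (I - u u^T) s = - (A u - theta u),  theta = u^T A u.
   Note that mat theta is theta I. *)
definition correction_residual :: "real^'n^'n \<Rightarrow> real^'n \<Rightarrow> real^'n \<Rightarrow> real^'n" where
  "correction_residual A u s =
     (proj_perp u ** (A - mat (rayleigh A u)) ** proj_perp u) *v s
       - (- (A *v u - rayleigh A u *\<^sub>R u))"

(* Solution in the orthogonal complement of u, up to a residual of norm at most tol;
   tol = 0 means an exact solution. *)
definition correction_solution ::
    "real \<Rightarrow> real^'n^'n \<Rightarrow> real^'n \<Rightarrow> real^'n \<Rightarrow> bool" where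
  "correction_solution tol A u s \<longleftrightarrow>
     orthogonal u s \<and> norm (correction_residual A u s) \<le> tol"

definition newton_iteration ::
    "(nat \<Rightarrow> real) \<Rightarrow> real^'n^'n \<Rightarrow> (nat \<Rightarrow> real^'n) \<Rightarrow> (nat \<Rightarrow> real^'n) \<Rightarrow> bool" where
  "newton_iteration tol A u s \<longleftrightarrow>
     norm (u 0) = 1 \<and>
     (\<forall>k. correction_solution (tol k) A (u k) (s k)) \<and>
     (\<forall>k. u (Suc k) = (u k + s k) /\<^sub>R norm (u k + s k))"

lemma correction_solution_exact_iff:
  "correction_solution 0 A u s \<longleftrightarrow> orthogonal u s \<and>
     (proj_perp u ** (A - mat (rayleigh A u)) ** proj_perp u) *v s
       = - (A *v u - rayleigh A u *\<^sub>R u)"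
  by (simp only: correction_solution_def correction_residual_def norm_le_zero_iff
      right_minus_eq)

lemma norm_add_correction:
  assumes "norm u = 1" "orthogonal u s"
  shows "norm (u + s) = sqrt (1 + (norm s)\<^sup>2)"
  using norm_add_Pythagorean[OF assms(2)] assms(1)
  by (metis norm_ge_zero one_power2 real_sqrt_unique)

end

theory Submission
  imports Defs
begin

text \<open>
  The contraction of the errors gives \<open>\<parallel>u\<^sub>k\<^sub>+\<^sub>1 - u\<^sub>k\<parallel> \<le> 2\<parallel>e\<^sub>k\<parallel>\<close>. Since \<open>s\<^sub>k\<close> is orthogonal to the unit
  vector \<open>u\<^sub>k\<close>, we have \<open>\<parallel>u\<^sub>k\<^sub>+\<^sub>1 - u\<^sub>k\<parallel>\<^sup>2 = 2 - 2 / \<surd>(1 + \<parallel>s\<^sub>k\<parallel>\<^sup>2)\<close>, so \<open>\<parallel>s\<^sub>k\<parallel>\<close> is controlled by this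
  distance; for small errors the resulting factor \<open>2 + o(1)\<close> is below \<open>3\<close>.
\<close>

text \<open>By orthogonality \<open>norm (u k + s k)\<close> is at least 1, so the normalization
  never divides by zero.\<close>

lemma norm_newton_iterate:
  assumes "newton_iteration tol A u s"
  shows "norm (u k) = 1"
proof (induction k)
  case 0
  then show ?case using assms by (simp add: newton_iteration_def)
next
  case (Suc k)
  have orth: "orthogonal (u k) (s k)" and step: "u (Suc k) = (u k + s k) /\<^sub>R norm (u k + s k)"
    using assms by (auto simp: newton_iteration_def correction_solution_def)
  have "norm (u k + s k) > 0"
    unfolding norm_add_correction[OF Suc.IH orth] by (simp add: add_pos_nonneg)
  then show ?case by (simp add: step)
qed

text \<open>Two unit vectors \<open>u\<close>, \<open>w\<close> have squared distance
  \<open>2 - 2 * (u \<bullet> w)\<close>; since \<open>s\<close> is orthogonal to \<open>u\<close>,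
  only \<open>u \<bullet> u = 1\<close> survives in the numerator of
  \<open>u \<bullet> w\<close>.\<close>

lemma norm_normalized_diff:
  fixes u s :: "real^'n"
  assumes "norm u = 1" "orthogonal u s"
  shows "(norm ((u + s) /\<^sub>R norm (u + s) - u))\<^sup>2 = 2 - 2 / norm (u + s)"
proof -
  define w where "w = (u + s) /\<^sub>R norm (u + s)"
  have "norm (u + s) > 0"
    unfolding norm_add_correction[OF assms] by (simp add: add_pos_nonneg)
  then have "norm w = 1" by (simp add: w_def)
  then have "w \<bullet> w = 1" by (simp add: dot_square_norm)
  moreover have uu: "u \<bullet> u = 1" using assms(1) by (simp add: dot_square_norm)
  moreover have "u \<bullet> w = 1 / norm (u + s)"
    using assms(2) uu by (simp add: w_def inner_add_right orthogonal_def divide_inverse)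
  ultimately show ?thesis
    unfolding w_def[symmetric]
    by (simp add: power2_norm_eq_inner inner_diff_left inner_diff_right inner_commute)
qed

text \<open>With \<open>t\<close> the square of \<epsilon>, the distance bound yields
  \<open>1 + (norm s)\<^sup>2 \<le> 1 / (1 - 2 * t)\<^sup>2\<close>, which is
  \<open>1 + 4 * t\<close> to first order; the gap between 4 and 9 absorbs the higher terms.\<close>

lemma norm_correction_le:
  fixes u s :: "real^'n"
  assumes u: "norm u = 1" "orthogonal u s"
    and dist: "norm ((u + s) /\<^sub>R norm (u + s) - u) \<le> 2 * \<epsilon>"
    and \<epsilon>: "0 \<le> \<epsilon>" "\<epsilon> \<le> 1/3"
  shows "norm s \<le> 3 * \<epsilon>"
proof -
  define N where "N = norm (u + s)"
  define t where "t = \<epsilon>\<^sup>2"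
  have t: "0 \<le> t" "t \<le> 1/9"
    using power_mono[OF \<epsilon>(2,1), of 2] by (auto simp: t_def power2_eq_square)
  have N: "N > 0"
    unfolding N_def norm_add_correction[OF u] by (simp add: add_pos_nonneg)
  have N2: "N\<^sup>2 = 1 + (norm s)\<^sup>2"
    unfolding N_def norm_add_correction[OF u] by simp
  have "2 - 2 / N \<le> (2 * \<epsilon>)\<^sup>2"
    unfolding N_def norm_normalized_diff[OF u, symmetric]
    by (rule power_mono[OF dist]) simp
  then have "N * (1 - 2 * t) \<le> 1"
    using N by (simp add: t_def field_simps)
  then have "(N * (1 - 2 * t))\<^sup>2 \<le> 1"
    using N t by (intro power_le_one) auto
  \<comment> \<open>The bracket is positive because \<open>32 * t \<le> 32/9 < 5\<close>.\<close>
  also have "1 \<le> 1 + t * (5 - 32 * t + 36 * t\<^sup>2)"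
    using t by simp
  also have "\<dots> = (1 + 9 * t) * (1 - 2 * t)\<^sup>2"
    by algebra
  finally have "N\<^sup>2 * (1 - 2 * t)\<^sup>2 \<le> (1 + 9 * t) * (1 - 2 * t)\<^sup>2"
    by (simp add: power_mult_distrib)
  moreover have "(1 - 2 * t)\<^sup>2 > 0" using t by simp
  ultimately have "N\<^sup>2 \<le> 1 + 9 * t"
    by (rule mult_right_le_imp_le)
  then have "(norm s)\<^sup>2 \<le> (3 * \<epsilon>)\<^sup>2"
    by (simp add: N2 t_def power_mult_distrib)
  then show ?thesis
    by (rule power2_le_imp_le) (use \<epsilon> in simp)
qed

theorem lemma3p4:
  fixes A :: "real^'n^'n"
    and lam :: "nat \<Rightarrow> real"
    and v1 :: "real^'n"
    and u s e :: "nat \<Rightarrow> real^'n"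
    and tol :: "nat \<Rightarrow> real"
  assumes A: "sym_pos_def A"
    and lam_less: "strict_mono_on {1..CARD('n)} lam"
    and spectrum: "{l. eigenvalue A l} = lam ` {1..CARD('n)}"
    and v1: "eigenvector A v1 (lam 1)" "norm v1 = 1"
    and iteration: "newton_iteration tol A u s"
    and e: "\<And>k. e k = u k - v1"
    and convergence: "\<exists>r<1. \<forall>k. norm (e (Suc k)) < r * norm (e k)"
  shows "\<exists>\<delta>>0. \<forall>k. norm (e k) < \<delta> \<longrightarrow> norm (s k) \<le> 3 * norm (e k)"
\<comment> \<open>The radius 1/3 is the range of \<epsilon> in \<open>norm_correction_le\<close>,
  hence independent of \<open>k\<close>.\<close>
proof (intro exI[of _ "1/3"] conjI allI impI)
  fix k
  assume small: "norm (e k) < 1/3"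
  obtain r where r: "r < 1" "norm (e (Suc k)) < r * norm (e k)"
    using convergence by blast
  have orth: "orthogonal (u k) (s k)" and step: "u (Suc k) = (u k + s k) /\<^sub>R norm (u k + s k)"
    using iteration by (auto simp: newton_iteration_def correction_solution_def)
  have "r * norm (e k) \<le> norm (e k)"
    using mult_right_mono[of r 1 "norm (e k)"] r(1) by simp
  with r(2) have "norm (e (Suc k)) \<le> norm (e k)" by simp
  \<comment> \<open>The vector \<open>v1\<close> cancels in \<open>e (Suc k) - e k\<close>.\<close>
  moreover have "norm (u (Suc k) - u k) \<le> norm (e (Suc k)) + norm (e k)"
    using norm_triangle_ineq4[of "e (Suc k)" "e k"] by (simp add: e)
  ultimately have "norm (u (Suc k) - u k) \<le> 2 * norm (e k)" by simp
  then show "norm (s k) \<le> 3 * norm (e k)"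
    using small norm_newton_iterate[OF iteration] orth
    by (intro norm_correction_le[of "u k"]) (auto simp flip: step)
qed simp

end
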